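(* Let $f:[a,b]\to\mathbb{R}$ be a continuous nondecreasing function, let $(\Delta_n)_{n\geq 1}$ be a sequence of partitions of $[a,b]$ such that $\|\Delta_n\|\to 0$, and let $p\in[1,\infty)$. Then for any nonnegative integer $l$ and any integer $m\geq 2l+1$, the sequence $\left(\mathbf{SI}_{m}^{l}(\Delta_n,f,p)\right)_{n\geq 1}$ converges uniformly to $f$ on any interval $[c,d]$ with $a<c<d<b$.
   Context: Let $[a,b]$ be a compact interval with $a<b$. A partition $\Delta$ of $[a,b]$ is a finite vector of knots $\Delta=(\alpha_1,\dots,\alpha_k)$ with $a=\alpha_1<\alpha_2<\dots<\alpha_k=b$; its norm is $\|\Delta\|=\max\{\alpha_{i+1}-\alpha_i : 1\le i\le k-1\}$. In a sequence $(\Delta_n)_{n\ge1}$ of partitions, $\Delta_n$ may have an arbitrary number $k_n$ of knots, and the partitions need not be nested. For an integer $m\ge1$, a function $g:[a,b]\to\mathbb{R}$ is $\Delta$-piecewise polynomial of order $m$ if its restriction to each $[\alpha_i,\alpha_{i+1}]$, $1\le i\le k-1$, is a polynomial function of degree at most $m$. For integers $0\le l\le m-1$, $\mathbf{SI}_m^l(\Delta)$ denotes the set of all nondecreasing functions $g:[a,b]\to\mathbb{R}$ that are $\Delta$-piecewise polynomial of order $m$ and belong to $C^l[a,b]$ (continuously differentiable up to order $l$ on $[a,b]$; $C^0[a,b]=C[a,b]$ is the space of continuous functions). For $p\in[1,\infty)$, $\|g\|_p=\left(\int_a^b|g(x)|^p\,dx\right)^{1/p}$. For continuous $f:[a,b]\to\mathbb{R}$,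 $\mathbf{SI}_m^l(\Delta,f,p)$ denotes the best $L^p$ approximation of $f$ in $\mathbf{SI}_m^l(\Delta)$, i.e. the unique element of $\mathbf{SI}_m^l(\Delta)$ such that $\|f-\mathbf{SI}_m^l(\Delta,f,p)\|_p=\min_{g\in\mathbf{SI}_m^l(\Delta)}\|f-g\|_p$ (existence and uniqueness hold for every $p\in[1,\infty)$ and every continuous $f$). *)

theory Defs
  imports "HOL-Analysis.Analysis" "HOL-Computational_Algebra.Polynomial"
begin

definition is_partition :: "real \<Rightarrow> real \<Rightarrow> real list \<Rightarrow> bool" where
  "is_partition a b \<Delta> \<longleftrightarrow>
     \<Delta> \<noteq> [] \<and> sorted_wrt (<) \<Delta> \<and> hd \<Delta> = a \<and> last \<Delta> = b"

text \<open>For a partition of an interval with \<open>a < b\<close> there are at least two knots, so the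
  maximum is taken over a nonempty finite set.\<close>

definition partition_norm :: "real list \<Rightarrow> real" where
  "partition_norm \<Delta> = Max {\<Delta> ! Suc i - \<Delta> ! i | i. Suc i < length \<Delta>}"

definition piecewise_poly :: "nat \<Rightarrow> real list \<Rightarrow> (real \<Rightarrow> real) \<Rightarrow> bool" where
  "piecewise_poly m \<Delta> g \<longleftrightarrow>
     (\<forall>i. Suc i < length \<Delta> \<longrightarrow>
        (\<exists>q :: real poly. degree q \<le> m \<and> (\<forall>x \<in> {\<Delta> ! i..\<Delta> ! Suc i}. g x = poly q x)))"

text \<open>Here \<open>D i\<close> is the \<open>i\<close>-th derivative of \<open>g\<close>; derivatives at the endpoints \<open>a\<close> and \<open>b\<close>
  are one-sided.\<close>

definition C_diff_on :: "nat \<Rightarrow> real \<Rightarrow> real \<Rightarrow> (real \<Rightarrow> real) \<Rightarrow> bool" where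
  "C_diff_on l a b g \<longleftrightarrow>
     (\<exists>D :: nat \<Rightarrow> real \<Rightarrow> real.
        D 0 = g \<and>
        (\<forall>i<l. \<forall>x\<in>{a..b}. (D i has_real_derivative D (Suc i) x) (at x within {a..b})) \<and>
        (\<forall>i\<le>l. continuous_on {a..b} (D i)))"

text \<open>Functions on \<open>[a,b]\<close> are represented by total functions whose values outside \<open>[a,b]\<close>
  are unconstrained and never used.\<close>

definition SI :: "nat \<Rightarrow> nat \<Rightarrow> real \<Rightarrow> real \<Rightarrow> real list \<Rightarrow> (real \<Rightarrow> real) set" where
  "SI m l a b \<Delta> = {g. mono_on {a..b} g \<and> piecewise_poly m \<Delta> g \<and> C_diff_on l a b g}"

definition Lp_norm :: "real \<Rightarrow> real \<Rightarrow> real \<Rightarrow> (real \<Rightarrow> real) \<Rightarrow> real" where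
  "Lp_norm p a b g = (integral {a..b} (\<lambda>x. \<bar>g x\<bar> powr p)) powr (1 / p)"

text \<open>The best approximation is unique only as a function on \<open>[a,b]\<close>, hence a predicate:
  \<open>s\<close> is a best \<open>L\<^sup>p\<close> approximation of \<open>f\<close> in \<open>SI m l a b \<Delta>\<close>.\<close>

definition is_best_SI_approx ::
    "nat \<Rightarrow> nat \<Rightarrow> real \<Rightarrow> real \<Rightarrow> real list \<Rightarrow> (real \<Rightarrow> real) \<Rightarrow> real \<Rightarrow> (real \<Rightarrow> real) \<Rightarrow> bool" where
  "is_best_SI_approx m l a b \<Delta> f p s \<longleftrightarrow>
     s \<in> SI m l a b \<Delta> \<and>
     (\<forall>g \<in> SI m l a b \<Delta>. Lp_norm p a b (\<lambda>x. f x - s x) \<le> Lp_norm p a b (\<lambda>x. f x - g x))"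

end

theory Submission imports Defs begin

text \<open>Replacing \<open>f\<close> on each partition interval by a rescaled copy of the smooth step polynomial
  proportional to \<open>\<integral>\<^sub>0\<^sup>t u\<^sup>l (1 - u)\<^sup>l du\<close> yields a competitor in \<open>SI m l a b \<Delta>\<close> whose uniform
  distance to \<open>f\<close> is at most the modulus of continuity of \<open>f\<close> at the norm of the partition. Hence
  the best approximations converge to \<open>f\<close> in \<open>L\<^sup>p\<close>. Since they are nondecreasing and \<open>f\<close> is
  uniformly continuous, an error \<open>\<epsilon>\<close> at \<open>x \<in> [c,d]\<close> forces an error at least \<open>\<epsilon>/2\<close> on an interval of
  fixed length to the right or to the left of \<open>x\<close>, which bounds the \<open>L\<^sup>p\<close> error from below.\<close>

section \<open>A smooth step polynomial\<close>

lemma poly_antiderivative_exists: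
  fixes q :: "real poly"
  obtains P where "pderiv P = q" "poly P 0 = 0" "degree P \<le> Suc (degree q)"
proof
  let ?P = "\<Sum>i\<le>degree q. monom (coeff q i / real (Suc i)) (Suc i)"
  have "pderiv ?P = (\<Sum>i\<le>degree q. monom (coeff q i) i)"
    unfolding higher_pderiv_sum[where n = 1, simplified]
    by (intro sum.cong refl) (simp add: pderiv_monom del: of_nat_Suc)
  then show "pderiv ?P = q" by (simp add: poly_as_sum_of_monoms)
  show "poly ?P 0 = 0" by (simp add: poly_sum poly_monom)
  show "degree ?P \<le> Suc (degree q)"
    by (intro degree_sum_le) (auto intro: order_trans[OF degree_monom_le])
qed

lemma power_dvd_pderiv:
  fixes p q :: "real poly"
  assumes "p ^ Suc n dvd q"
  shows "p ^ n dvd pderiv q"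
proof -
  obtain r where "q = p ^ Suc n * r" using assms by (auto elim: dvdE)
  then have "pderiv q = pderiv (p ^ Suc n * r)" by (rule arg_cong)
  also have "\<dots> = p ^ n * (smult (of_nat (Suc n)) (pderiv p * r) + p * pderiv r)"
    unfolding pderiv_mult pderiv_power_Suc
    by (simp add: algebra_simps smult_add_right mult_smult_left del: of_nat_Suc)
  finally show ?thesis by simp
qed

text \<open>Each differentiation costs at most one factor \<open>p\<close>. The case
  \<open>n = 1\<close> is what makes derivatives of the step vanish at 0 and 1.\<close>

lemma power_dvd_iterated_pderiv:
  fixes p q :: "real poly"
  assumes "p ^ (n + k) dvd q"
  shows "p ^ n dvd (pderiv ^^ k) q"
  using assms
proof (induction k arbitrary: n)
  case (Suc k)
  have "p ^ Suc n dvd (pderiv ^^ k) q"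
    using Suc.IH[of "Suc n"] Suc.prems by simp
  then show ?case using power_dvd_pderiv by simp
qed simp

text \<open>The antiderivative of \<open>u ^ l * (1 - u) ^ l\<close>, normalised to the value 1 at
  1, has these properties: the integrand is nonnegative on the unit interval, which gives
  monotonicity, and its zeros of order \<open>l\<close> at both ends kill the derivatives of orders
  1 to \<open>l\<close>. Its degree bound \<open>2 * l + 1\<close> is the origin of the condition on
  \<open>m\<close> in the theorem.\<close>

lemma smooth_step_poly_exists:
  obtains H :: "real poly" where
    "degree H \<le> 2 * l + 1" "poly H 0 = 0" "poly H 1 = 1" "mono_on {0..1} (poly H)"
    "\<And>k. 1 \<le> k \<Longrightarrow> k \<le> l \<Longrightarrow> poly ((pderiv ^^ k) H) 0 = 0 \<and> poly ((pderiv ^^ k) H) 1 = 0"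
proof -
  define q :: "real poly" where "q = [:0, 1:] ^ l * [:1, -1:] ^ l"
  have deg: "degree q \<le> 2 * l"
    unfolding q_def
    by (rule order_trans[OF degree_mult_le]) (simp add: degree_power_eq)
  have q_eval: "poly q x = x ^ l * (1 - x) ^ l" for x
    by (simp add: q_def poly_power)
  obtain P where P: "pderiv P = q" "poly P 0 = 0" "degree P \<le> Suc (degree q)"
    using poly_antiderivative_exists .
  have der: "(poly P has_real_derivative poly q x) (at x)" for x
    using poly_DERIV[of P x] P(1) by simp
  \<comment> \<open>The strict inequality permits the division by \<open>poly P 1\<close> that
    normalises the step.\<close>
  have "poly P 0 < poly P 1"
  proof (rule DERIV_pos_imp_increasing_open[where f = "poly P"])
    fix x :: real assume "0 < x" "x < 1"
    then show "\<exists>y. (poly P has_real_derivative y) (at x) \<and> 0 < y"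
      using der[of x] by (auto intro!: exI[of _ "poly q x"] simp: q_eval)
  qed (auto intro: continuous_intros)
  then have pos: "poly P 1 > 0" using P(2) by simp
  define H where "H = smult (1 / poly P 1) P"
  show thesis
  proof
    show "degree H \<le> 2 * l + 1" using P(3) deg by (simp add: H_def)
    show "poly H 0 = 0" "poly H 1 = 1" using P(2) pos by (simp_all add: H_def)
    show "mono_on {0..1} (poly H)"
    proof (rule mono_onI)
      fix x y :: real assume xy: "x \<in> {0..1}" "y \<in> {0..1}" "x \<le> y"
      have "poly P x \<le> poly P y"
      proof (rule DERIV_nonneg_imp_nondecreasing[OF xy(3)])
        fix z assume "x \<le> z" "z \<le> y"
        then show "\<exists>y. (poly P has_real_derivative y) (at z) \<and> 0 \<le> y"
          using der[of z] xy by (auto intro!: exI[of _ "poly q z"] simp: q_eval)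
      qed
      then show "poly H x \<le> poly H y"
        using pos by (simp add: H_def divide_right_mono)
    qed
    fix k assume k: "1 \<le> k" "k \<le> l"
    then obtain j where j: "k = Suc j" by (cases k) auto
    have Hq: "pderiv H = smult (1 / poly P 1) q" by (simp add: H_def pderiv_smult P(1))
    \<comment> \<open>Since \<open>pderiv H\<close> is a multiple of \<open>q\<close>, only
      \<open>j = k - 1\<close> further differentiations act on it. As \<open>Suc j \<le> l\<close>,
      at least one factor \<open>p\<close> survives them.\<close>
    have root: "poly ((pderiv ^^ k) H) x = 0" if "p ^ l dvd q" "poly p x = 0" for p and x :: real
    proof -
      have "p ^ Suc j dvd q" using power_le_dvd[OF that(1), of "Suc j"] k j by simp
      then have "p ^ (1 + j) dvd pderiv H" unfolding Hq by (simp add: dvd_smult)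
      then have "p ^ 1 dvd (pderiv ^^ j) (pderiv H)" by (rule power_dvd_iterated_pderiv)
      then have "p dvd (pderiv ^^ k) H" by (simp add: j funpow_swap1)
      then show ?thesis using that(2) by (auto elim!: dvdE)
    qed
    show "poly ((pderiv ^^ k) H) 0 = 0 \<and> poly ((pderiv ^^ k) H) 1 = 0"
      using root[of "[:0, 1:]" 0] root[of "[:1, -1:]" 1] by (simp add: q_def)
  qed
qed

section \<open>Extension of the step by constants\<close>

text \<open>Composition with the clamp extends a step by 0 to the left and by 1 to the right. A
  spline then becomes one global sum of such steps, and no pieces have to be glued at the
  knots.\<close>

definition clamp01 :: "real \<Rightarrow> real" where
  "clamp01 t = max 0 (min 1 t)"

lemma continuous_on_clamp01 [continuous_intros]:
  "continuous_on S g \<Longrightarrow> continuous_on S (\<lambda>x. clamp01 (g x))"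
  unfolding clamp01_def by (intro continuous_intros)

lemma clamp01_mono: "s \<le> t \<Longrightarrow> clamp01 s \<le> clamp01 t"
  by (auto simp: clamp01_def)

lemma clamp01_in: "clamp01 t \<in> {0..1}"
  by (auto simp: clamp01_def)

lemma abs_clamp01_diff_le: "\<bar>clamp01 s - clamp01 t\<bar> \<le> \<bar>s - t\<bar>"
  by (auto simp: clamp01_def)

text \<open>Strictly between 0 and 1 the clamp is locally the identity. For every other
  \<open>t\<close> the clamped point is 0 or 1, where the derivative of \<open>P\<close> vanishes,
  and the little-o estimate there carries over to \<open>t\<close> because \<open>clamp01\<close> is
  1-Lipschitz. This treats the kinks and the constant parts together.\<close>

lemma DERIV_poly_clamp01:
  assumes "poly (pderiv P) 0 = 0" "poly (pderiv P) 1 = 0"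
  shows "((\<lambda>t. poly P (clamp01 t)) has_real_derivative poly (pderiv P) (clamp01 t)) (at t)"
proof (cases "0 < t \<and> t < 1")
  case True
  then have cl: "clamp01 t = t" by (simp add: clamp01_def)
  have "(poly P has_real_derivative poly (pderiv P) t) (at t)" by (rule poly_DERIV)
  then show ?thesis unfolding cl
    by (rule has_field_derivative_transform_within_open[where S = "{0<..<1}"])
      (use True in \<open>auto simp: clamp01_def\<close>)
next
  case False
  then have "clamp01 t = 0 \<or> clamp01 t = 1" by (auto simp: clamp01_def)
  then have z: "poly (pderiv P) (clamp01 t) = 0" using assms by auto
  have "(poly P has_derivative (\<lambda>h. 0)) (at (clamp01 t))"
    using poly_DERIV[of P "clamp01 t"] z by (simp add: has_field_derivative_def lambda_zero)
  then have lim: "\<forall>e>0. \<exists>d>0. \<forall>y. \<bar>y - clamp01 t\<bar> < d \<longrightarrow>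
      \<bar>poly P y - poly P (clamp01 t)\<bar> \<le> e * \<bar>y - clamp01 t\<bar>"
    unfolding has_derivative_at_alt by simp
  have "\<exists>d>0. \<forall>y. \<bar>y - t\<bar> < d \<longrightarrow>
      \<bar>poly P (clamp01 y) - poly P (clamp01 t)\<bar> \<le> e * \<bar>y - t\<bar>" if "e > 0" for e
  proof -
    obtain d where "d > 0" and d: "\<And>y. \<bar>y - clamp01 t\<bar> < d \<Longrightarrow>
        \<bar>poly P y - poly P (clamp01 t)\<bar> \<le> e * \<bar>y - clamp01 t\<bar>"
      using lim \<open>e > 0\<close> by blast
    have "\<bar>poly P (clamp01 y) - poly P (clamp01 t)\<bar> \<le> e * \<bar>y - t\<bar>" if "\<bar>y - t\<bar> < d" for y
    proof -
      have "\<bar>poly P (clamp01 y) - poly P (clamp01 t)\<bar> \<le> e * \<bar>clamp01 y - clamp01 t\<bar>"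
        using that abs_clamp01_diff_le[of y t] by (intro d) simp
      also have "\<dots> \<le> e * \<bar>y - t\<bar>"
        using abs_clamp01_diff_le[of y t] \<open>e > 0\<close> by simp
      finally show ?thesis .
    qed
    with \<open>d > 0\<close> show ?thesis by blast
  qed
  then have "((\<lambda>t. poly P (clamp01 t)) has_derivative (\<lambda>h. 0)) (at t)"
    unfolding has_derivative_at_alt by simp
  then show ?thesis by (simp add: has_field_derivative_def z lambda_zero)
qed

section \<open>Monotone spline interpolation\<close>

lemma is_partition_length:
  assumes "is_partition a b xs" "a < b"
  shows "2 \<le> length xs" "xs ! 0 = a" "xs ! (length xs - 1) = b"
proof -
  have ne: "xs \<noteq> []" and hd: "hd xs = a" and last: "last xs = b"
    using assms(1) by (auto simp: is_partition_def)
  show "xs ! 0 = a" using hd ne by (simp add: hd_conv_nth)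
  show "xs ! (length xs - 1) = b" using last ne by (simp add: last_conv_nth)
  show "2 \<le> length xs"
    using ne hd last assms(2) by (cases xs; cases "tl xs") auto
qed

lemma is_partition_nth_less:
  assumes "is_partition a b xs" "i < j" "j < length xs"
  shows "xs ! i < xs ! j"
  using assms sorted_wrt_nth_less unfolding is_partition_def by blast

lemma is_partition_nth_mono:
  assumes "is_partition a b xs" "i \<le> j" "j < length xs"
  shows "xs ! i \<le> xs ! j"
  using is_partition_nth_less[OF assms(1) _ assms(3), of i] assms(2) by (cases "i = j") auto

lemma is_partition_nth_in:
  assumes "is_partition a b xs" "a < b" "i < length xs"
  shows "xs ! i \<in> {a..b}"
  using is_partition_nth_mono[OF assms(1), of 0 i]
    is_partition_nth_mono[OF assms(1), of i "length xs - 1"]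
    is_partition_length[OF assms(1,2)] assms(3) by auto

lemma is_partition_interval:
  assumes "is_partition a b xs" "a < b" "x \<in> {a..b}"
  obtains j where "Suc j < length xs" "x \<in> {xs ! j..xs ! Suc j}"
proof -
  note len = is_partition_length[OF assms(1,2)]
  \<comment> \<open>Minimality puts \<open>x\<close> to the right of knot \<open>j\<close>; for
    \<open>j = 0\<close> this is \<open>a \<le> x\<close>.\<close>
  define j where "j = (LEAST j. x \<le> xs ! Suc j)"
  \<comment> \<open>The index \<open>length xs - 2\<close> belongs to the last interval, whose right
    knot is \<open>b\<close>. It also bounds \<open>j\<close>, so that \<open>Suc j\<close> is a
    genuine index of the list.\<close>
  have ex: "x \<le> xs ! Suc (length xs - 2)"
    using len assms(3) by (simp flip: Suc_diff_le add: numeral_2_eq_2)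
  have up: "x \<le> xs ! Suc j" unfolding j_def by (rule LeastI[of "\<lambda>j. x \<le> xs ! Suc j", OF ex])
  have le: "j \<le> length xs - 2" unfolding j_def by (rule Least_le[of "\<lambda>j. x \<le> xs ! Suc j", OF ex])
  have "xs ! j \<le> x"
  proof (cases j)
    case 0 then show ?thesis using len assms(3) by simp
  next
    case (Suc i)
    then have "\<not> x \<le> xs ! Suc i"
      using not_less_Least[of i "\<lambda>j. x \<le> xs ! Suc j"] unfolding j_def by simp
    then show ?thesis using Suc by simp
  qed
  with up le len(1) show thesis by (intro that[of j]) auto
qed

lemma partition_norm_ge:
  assumes "Suc i < length xs"
  shows "xs ! Suc i - xs ! i \<le> partition_norm xs"
  unfolding partition_norm_def
proof (rule Max_ge)
  have "{xs ! Suc i - xs ! i |i. Suc i < length xs}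
      = (\<lambda>i. xs ! Suc i - xs ! i) ` {i. Suc i < length xs}" by auto
  moreover have "finite {i. Suc i < length xs}"
    by (rule finite_subset[of _ "{..<length xs}"]) auto
  ultimately show "finite {xs ! Suc i - xs ! i |i. Suc i < length xs}" by simp
qed (use assms in auto)

text \<open>The interpolant is \<open>f a\<close> plus, for each partition interval, the increment
  of \<open>f\<close> times a clamped step rescaled to that interval. Increments are nonnegative, so
  the sum is nondecreasing; the steps are smooth on the whole line, so the sum is smooth as
  well.\<close>

lemma SI_interpolant_exists:
  fixes f :: "real \<Rightarrow> real"
  assumes ab: "a < b" and part: "is_partition a b xs" and f: "mono_on {a..b} f"
    and m: "m \<ge> 2 * l + 1"
  obtains g where "g \<in> SI m l a b xs" "\<And>i. i < length xs \<Longrightarrow> g (xs ! i) = f (xs ! i)"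
proof -
  note len = is_partition_length[OF part ab]
  obtain H :: "real poly" where H: "degree H \<le> 2 * l + 1" "poly H 0 = 0" "poly H 1 = 1"
    "mono_on {0..1} (poly H)"
    and H0: "\<And>k. 1 \<le> k \<Longrightarrow> k \<le> l \<Longrightarrow> poly ((pderiv ^^ k) H) 0 = 0 \<and> poly ((pderiv ^^ k) H) 1 = 0"
    by (rule smooth_step_poly_exists[of l]) blast
  define N where "N = length xs - 1"
  define h where "h i = xs ! Suc i - xs ! i" for i
  define w where "w i = f (xs ! Suc i) - f (xs ! i)" for i
  define u where "u i x = clamp01 ((x - xs ! i) / h i)" for i x
  \<comment> \<open>\<open>D k\<close> is the k-th derivative of the interpolant \<open>D 0\<close>
    for \<open>k \<le> l\<close>: each order brings a factor \<open>1 / h i\<close> from the chain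
    rule, and the constant \<open>f a\<close> is present only at order 0.\<close>
  define D where "D k x = (if k = 0 then f a else 0)
      + (\<Sum>i<N. w i / h i ^ k * poly ((pderiv ^^ k) H) (u i x))" for k x
  have hpos: "h i > 0" if "i < N" for i
    using is_partition_nth_less[OF part, of i "Suc i"] that by (simp add: h_def N_def)
  have wpos: "w i \<ge> 0" if "i < N" for i
    using mono_onD[OF f is_partition_nth_in[OF part ab] is_partition_nth_in[OF part ab], of i "Suc i"]
      is_partition_nth_mono[OF part, of i "Suc i"] that by (simp add: w_def N_def)
  \<comment> \<open>The bound \<open>k < l\<close> is needed because differentiating through the
    clamp requires the derivative of order \<open>Suc k\<close> of \<open>H\<close> to vanish at 0
    and 1.\<close>
  have deriv: "(D k has_real_derivative D (Suc k) x) (at x)" if "k < l" for k x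
  proof -
    have "((\<lambda>x. poly ((pderiv ^^ k) H) (u i x)) has_real_derivative
        poly ((pderiv ^^ Suc k) H) (u i x) * (1 / h i)) (at x)" if "i < N" for i
    proof -
      have "((\<lambda>x. (x - xs ! i) / h i) has_real_derivative 1 / h i) (at x)"
        by (intro DERIV_cdivide) (auto intro!: derivative_eq_intros)
      moreover have "((\<lambda>t. poly ((pderiv ^^ k) H) (clamp01 t)) has_real_derivative
          poly ((pderiv ^^ Suc k) H) (u i x)) (at ((x - xs ! i) / h i))"
        using DERIV_poly_clamp01[of "(pderiv ^^ k) H" "(x - xs ! i) / h i"]
          H0[of "Suc k"] \<open>k < l\<close> by (simp add: u_def)
      ultimately show ?thesis unfolding u_def by (rule DERIV_chain2[rotated])
    qed
    then have "(D k has_real_derivative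
        0 + (\<Sum>i<N. w i / h i ^ k * (poly ((pderiv ^^ Suc k) H) (u i x) * (1 / h i)))) (at x)"
      unfolding D_def by (intro DERIV_add DERIV_const DERIV_sum DERIV_cmult) auto
    moreover have "0 + (\<Sum>i<N. w i / h i ^ k * (poly ((pderiv ^^ Suc k) H) (u i x) * (1 / h i)))
        = D (Suc k) x"
      by (simp add: D_def mult_ac)
    ultimately show ?thesis by simp
  qed
  have cont: "continuous_on {a..b} (D k)" for k
  proof -
    have "continuous_on {a..b} (\<lambda>x. u i x)" if "i < N" for i
      using hpos[OF that] unfolding u_def
      by (intro continuous_on_clamp01 continuous_on_divide continuous_on_diff continuous_on_id
          continuous_on_const) auto
    then show ?thesis unfolding D_def
      by (intro continuous_on_add continuous_on_const continuous_on_sum continuous_on_mult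
          continuous_on_poly) auto
  qed
  have C: "C_diff_on l a b (D 0)"
    unfolding C_diff_on_def
    using deriv cont by (intro exI[of _ D]) (auto intro: has_field_derivative_at_within)
  have mono: "mono_on {a..b} (D 0)"
  proof (rule mono_onI)
    fix x y assume "x \<in> {a..b}" "y \<in> {a..b}" "x \<le> y"
    have "poly H (u i x) \<le> poly H (u i y)" if "i < N" for i
      unfolding u_def
      by (intro mono_onD[OF H(4)] clamp01_in clamp01_mono divide_right_mono)
        (use \<open>x \<le> y\<close> hpos[OF that] in auto)
    then show "D 0 x \<le> D 0 y"
      unfolding D_def by (auto intro!: sum_mono mult_left_mono wpos)
  qed
  \<comment> \<open>On interval \<open>j\<close> the earlier steps have reached 1 and the later ones
    are still 0. The completed increments telescope to \<open>f (xs ! j) - f a\<close>.\<close>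
  have on_interval: "D 0 x = f (xs ! j) + w j * poly H ((x - xs ! j) / h j)"
    if j: "j < N" and x: "x \<in> {xs ! j..xs ! Suc j}" for j x
  proof -
    have before: "u i x = 1" if "i < j" for i
    proof -
      have "xs ! Suc i \<le> xs ! j"
        using is_partition_nth_mono[OF part, of "Suc i" j] that j by (simp add: N_def)
      then have "1 \<le> (x - xs ! i) / h i"
        using x hpos[of i] that j by (simp add: pos_le_divide_eq) (simp add: h_def)
      then show ?thesis by (simp add: u_def clamp01_def)
    qed
    have after: "u i x = 0" if "j < i" "i < N" for i
    proof -
      have "xs ! Suc j \<le> xs ! i"
        using is_partition_nth_mono[OF part, of "Suc j" i] that by (simp add: N_def)
      then have "(x - xs ! i) / h i \<le> 0"
        using x hpos[of i] that by (simp add: divide_le_0_iff)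
      then show ?thesis by (simp add: u_def clamp01_def)
    qed
    have at: "u j x = (x - xs ! j) / h j"
      using x hpos[OF j] by (auto simp: u_def clamp01_def h_def)
    have split: "{..<N} = {..<j} \<union> insert j {j<..<N}" using j by auto
    have "(\<Sum>i<N. w i * poly H (u i x))
        = (\<Sum>i<j. w i * poly H (u i x)) + (\<Sum>i\<in>insert j {j<..<N}. w i * poly H (u i x))"
      unfolding split by (rule sum.union_disjoint) auto
    also have "(\<Sum>i<j. w i * poly H (u i x)) = (\<Sum>i<j. w i)"
      by (intro sum.cong) (simp_all add: before H(3))
    also have "\<dots> = f (xs ! j) - f a"
      unfolding w_def using sum_lessThan_telescope[of "\<lambda>i. f (xs ! i)" j] len(2) by simp
    also have "(\<Sum>i\<in>insert j {j<..<N}. w i * poly H (u i x)) = w j * poly H (u j x)"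
      by (subst sum.insert) (auto simp: after H(2))
    finally show ?thesis by (simp add: D_def at)
  qed
  have pw: "piecewise_poly m xs (D 0)"
    unfolding piecewise_poly_def
  proof (intro allI impI)
    fix j assume "Suc j < length xs"
    then have j: "j < N" by (simp add: N_def)
    \<comment> \<open>The clamp is inactive on this interval, so the moving term is \<open>H\<close>
      composed with an affine map, which does not raise the degree.\<close>
    define q where "q = [:f (xs ! j):] + smult (w j) (H \<circ>\<^sub>p [:- xs ! j / h j, 1 / h j:])"
    have "degree (H \<circ>\<^sub>p [:- xs ! j / h j, 1 / h j:]) \<le> 2 * l + 1"
      using H(1) hpos[OF j] by (simp add: degree_pcompose)
    then have "degree (smult (w j) (H \<circ>\<^sub>p [:- xs ! j / h j, 1 / h j:])) \<le> m"
      using degree_smult_le[of "w j" "H \<circ>\<^sub>p [:- xs ! j / h j, 1 / h j:]"] m by linarith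
    then have "degree q \<le> m" unfolding q_def by (intro degree_add_le) auto
    moreover have "D 0 x = poly q x" if "x \<in> {xs ! j..xs ! Suc j}" for x
      using on_interval[OF j that] by (simp add: q_def poly_pcompose diff_divide_distrib)
    ultimately show "\<exists>q. degree q \<le> m \<and> (\<forall>x\<in>{xs ! j..xs ! Suc j}. D 0 x = poly q x)"
      by blast
  qed
  show thesis
  proof
    show "D 0 \<in> SI m l a b xs" using mono pw C by (simp add: SI_def)
    fix i assume i: "i < length xs"
    show "D 0 (xs ! i) = f (xs ! i)"
    proof (cases "i < N")
      case True
      then show ?thesis
        using on_interval[OF True, of "xs ! i"] H(2) hpos[OF True] by (simp add: h_def)
    next
      case False
      \<comment> \<open>The last knot is no left endpoint, so it is reached as the right endpoint of
        the preceding interval, where \<open>H\<close> takes the value 1.\<close>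
      then obtain j where j: "i = Suc j" "j < N" using i len(1) by (cases i) (auto simp: N_def)
      then show ?thesis
        using on_interval[OF j(2), of "xs ! i"] H(3) hpos[OF j(2)] by (simp add: h_def w_def)
    qed
  qed
qed

text \<open>On each partition interval both \<open>f\<close> and its nondecreasing interpolant lie
  between the values of \<open>f\<close> at the two knots, and these differ by at most
  \<open>\<eta>\<close>.\<close>

lemma SI_close_approx_exists:
  fixes f :: "real \<Rightarrow> real"
  assumes ab: "a < b" and part: "is_partition a b xs" and f: "mono_on {a..b} f"
    and m: "m \<ge> 2 * l + 1"
    and modulus: "\<And>x y. x \<in> {a..b} \<Longrightarrow> y \<in> {a..b} \<Longrightarrow> \<bar>x - y\<bar> \<le> partition_norm xs \<Longrightarrow>
      \<bar>f x - f y\<bar> \<le> \<eta>"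
  obtains g where "g \<in> SI m l a b xs" "\<And>x. x \<in> {a..b} \<Longrightarrow> \<bar>f x - g x\<bar> \<le> \<eta>"
proof -
  obtain g where g: "g \<in> SI m l a b xs" and interp: "\<And>i. i < length xs \<Longrightarrow> g (xs ! i) = f (xs ! i)"
    by (rule SI_interpolant_exists[OF ab part f m]) blast
  have gm: "mono_on {a..b} g" using g by (simp add: SI_def)
  have "\<bar>f x - g x\<bar> \<le> \<eta>" if x: "x \<in> {a..b}" for x
  proof -
    obtain j where j: "Suc j < length xs" and xj: "x \<in> {xs ! j..xs ! Suc j}"
      using is_partition_interval[OF part ab x] .
    have in1: "xs ! j \<in> {a..b}" and in2: "xs ! Suc j \<in> {a..b}"
      using is_partition_nth_in[OF part ab] j by auto
    have "\<bar>f (xs ! Suc j) - f (xs ! j)\<bar> \<le> \<eta>"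
      using partition_norm_ge[OF j] is_partition_nth_mono[OF part, of j "Suc j"] j
      by (intro modulus in1 in2) auto
    moreover have "f (xs ! j) \<le> g x" "g x \<le> f (xs ! Suc j)"
      using mono_onD[OF gm in1 x] mono_onD[OF gm x in2] xj interp j by auto
    moreover have "f (xs ! j) \<le> f x" "f x \<le> f (xs ! Suc j)"
      using mono_onD[OF f in1 x] mono_onD[OF f x in2] xj by auto
    ultimately show ?thesis by linarith
  qed
  with g that show thesis by blast
qed

section \<open>From convergence in the p-norm to uniform convergence\<close>

lemma SI_continuous_on: "g \<in> SI m l a b xs \<Longrightarrow> continuous_on {a..b} g"
  by (auto simp: SI_def C_diff_on_def)

text \<open>Positivity of \<open>p\<close> keeps the power continuous at zeros of
  \<open>e\<close>.\<close>

lemma integrable_abs_powr: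
  fixes e :: "real \<Rightarrow> real"
  assumes "continuous_on {a..b} e" "p > 0"
  shows "(\<lambda>x. \<bar>e x\<bar> powr p) integrable_on {a..b}"
  using assms by (intro integrable_continuous_interval continuous_on_powr' continuous_intros) auto

text \<open>The outer power \<open>1 / p\<close> is strictly increasing on nonnegative reals, so
  best approximation can be exploited on the integrals themselves.\<close>

lemma Lp_norm_leD:
  assumes "Lp_norm p a b g \<le> Lp_norm p a b h" "p > 0"
    and "continuous_on {a..b} g" "continuous_on {a..b} h"
  shows "integral {a..b} (\<lambda>x. \<bar>g x\<bar> powr p) \<le> integral {a..b} (\<lambda>x. \<bar>h x\<bar> powr p)"
proof (rule ccontr)
  assume "\<not> ?thesis"
  moreover have "0 \<le> integral {a..b} (\<lambda>x. \<bar>h x\<bar> powr p)"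
    by (intro integral_nonneg integrable_abs_powr assms) auto
  ultimately have "Lp_norm p a b h < Lp_norm p a b g"
    unfolding Lp_norm_def using assms(2) by (intro powr_less_mono2) auto
  with assms(1) show False by simp
qed

lemma integral_abs_powr_ge:
  fixes e :: "real \<Rightarrow> real"
  assumes "continuous_on {a..b} e" "p > 0" "a \<le> u" "u \<le> v" "v \<le> b" "\<epsilon> \<ge> 0"
    and "\<And>x. x \<in> {u..v} \<Longrightarrow> \<epsilon> \<le> \<bar>e x\<bar>"
  shows "(v - u) * \<epsilon> powr p \<le> integral {a..b} (\<lambda>x. \<bar>e x\<bar> powr p)"
proof -
  have sub: "{u..v} \<subseteq> {a..b}" using assms by auto
  have int: "(\<lambda>x. \<bar>e x\<bar> powr p) integrable_on {u..v}"
    by (intro integrable_abs_powr continuous_on_subset[OF assms(1) sub] assms)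
  have "(v - u) * \<epsilon> powr p = integral {u..v} (\<lambda>x. \<epsilon> powr p)"
    using assms(4) by simp
  also have "\<dots> \<le> integral {u..v} (\<lambda>x. \<bar>e x\<bar> powr p)"
    using assms by (intro integral_le int) (auto intro: powr_mono2)
  also have "\<dots> \<le> integral {a..b} (\<lambda>x. \<bar>e x\<bar> powr p)"
    by (intro integral_subset_le sub int integrable_abs_powr assms(1,2)) auto
  finally show ?thesis .
qed

lemma integral_abs_powr_le:
  fixes e :: "real \<Rightarrow> real"
  assumes "continuous_on {a..b} e" "p > 0" "a \<le> b"
    and "\<And>x. x \<in> {a..b} \<Longrightarrow> \<bar>e x\<bar> \<le> \<eta>"
  shows "integral {a..b} (\<lambda>x. \<bar>e x\<bar> powr p) \<le> (b - a) * \<eta> powr p"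
proof -
  have "integral {a..b} (\<lambda>x. \<bar>e x\<bar> powr p) \<le> integral {a..b} (\<lambda>x. \<eta> powr p)"
    using assms by (intro integral_le integrable_abs_powr) (auto intro: powr_mono2)
  then show ?thesis using assms(3) by simp
qed

text \<open>Monotonicity of \<open>s\<close> carries an overshoot at \<open>x\<close> to the right
  and an undershoot to the left, while \<open>f\<close> recovers at most half of the error within
  distance \<open>\<delta>\<close>. Which side occurs is not known in advance, so \<open>x\<close>
  keeps distance \<open>\<delta>\<close> from both endpoints; this is why the convergence is
  obtained on interior intervals.\<close>

lemma mono_Lp_error_lower_bound:
  fixes f s :: "real \<Rightarrow> real"
  assumes s: "mono_on {a..b} s" "continuous_on {a..b} s" and f: "continuous_on {a..b} f"
    and p: "p > 0" and \<delta>: "\<delta> > 0" "a + \<delta> \<le> x" "x \<le> b - \<delta>" and \<epsilon>: "\<epsilon> > 0"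
    and modulus: "\<And>y. y \<in> {a..b} \<Longrightarrow> \<bar>y - x\<bar> \<le> \<delta> \<Longrightarrow> \<bar>f y - f x\<bar> \<le> \<epsilon> / 2"
    and far: "\<epsilon> \<le> \<bar>s x - f x\<bar>"
  shows "\<delta> * (\<epsilon> / 2) powr p \<le> integral {a..b} (\<lambda>x. \<bar>f x - s x\<bar> powr p)"
proof -
  have x: "x \<in> {a..b}" using \<delta> by auto
  have cont: "continuous_on {a..b} (\<lambda>x. f x - s x)"
    by (intro continuous_intros f s(2))
  consider "s x \<ge> f x + \<epsilon>" | "s x \<le> f x - \<epsilon>" using far by linarith
  then show ?thesis
  proof cases
    case 1
    have "\<epsilon> / 2 \<le> \<bar>f y - s y\<bar>" if "y \<in> {x..x + \<delta>}" for y
    proof -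
      have "s x \<le> s y" "\<bar>f y - f x\<bar> \<le> \<epsilon> / 2"
        using mono_onD[OF s(1) x, of y] modulus[of y] that x \<delta> by auto
      then show ?thesis using 1 by linarith
    qed
    then have "(x + \<delta> - x) * (\<epsilon> / 2) powr p \<le> integral {a..b} (\<lambda>x. \<bar>f x - s x\<bar> powr p)"
      using \<delta> x \<epsilon> by (intro integral_abs_powr_ge cont p) auto
    then show ?thesis by simp
  next
    case 2
    have "\<epsilon> / 2 \<le> \<bar>f y - s y\<bar>" if "y \<in> {x - \<delta>..x}" for y
    proof -
      have "s y \<le> s x" "\<bar>f y - f x\<bar> \<le> \<epsilon> / 2"
        using mono_onD[OF s(1) _ x, of y] modulus[of y] that x \<delta> by auto
      then show ?thesis using 2 by linarith
    qed
    then have "(x - (x - \<delta>)) * (\<epsilon> / 2) powr p \<le> integral {a..b} (\<lambda>x. \<bar>f x - s x\<bar> powr p)"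
      using \<delta> x \<epsilon> by (intro integral_abs_powr_ge cont p) auto
    then show ?thesis by simp
  qed
qed

lemma uniform_modulus:
  fixes f :: "real \<Rightarrow> real"
  assumes "continuous_on {a..b} f" "e > 0"
  obtains d where "d > 0"
    "\<And>x y. x \<in> {a..b} \<Longrightarrow> y \<in> {a..b} \<Longrightarrow> \<bar>x - y\<bar> < d \<Longrightarrow> \<bar>f x - f y\<bar> \<le> e"
proof -
  have "uniformly_continuous_on {a..b} f"
    by (rule compact_uniformly_continuous[OF assms(1) compact_Icc])
  then obtain d where "d > 0"
    and d: "\<And>x y. x \<in> {a..b} \<Longrightarrow> y \<in> {a..b} \<Longrightarrow> dist y x < d \<Longrightarrow> dist (f y) (f x) < e"
    unfolding uniformly_continuous_on_def using assms(2) by blast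
  show thesis
  proof (rule that[OF \<open>d > 0\<close>])
    fix x y assume "x \<in> {a..b}" "y \<in> {a..b}" "\<bar>x - y\<bar> < d"
    then show "\<bar>f x - f y\<bar> \<le> e" using d[of y x] by (simp add: dist_real_def)
  qed
qed

theorem corollary5:
  fixes a b c d p :: real and f :: "real \<Rightarrow> real" and \<Delta> :: "nat \<Rightarrow> real list"
    and l m :: nat and s :: "nat \<Rightarrow> real \<Rightarrow> real"
  assumes "a < b"
    and "continuous_on {a..b} f" and "mono_on {a..b} f"
    and "\<And>n. n \<ge> 1 \<Longrightarrow> is_partition a b (\<Delta> n)"
    and "(\<lambda>n. partition_norm (\<Delta> n)) \<longlonglongrightarrow> 0"
    and "p \<ge> 1"
    and "m \<ge> 2 * l + 1"
    and "\<And>n. n \<ge> 1 \<Longrightarrow> is_best_SI_approx m l a b (\<Delta> n) f p (s n)"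
    and "a < c" and "c < d" and "d < b"
  shows "uniform_limit {c..d} s f sequentially"
proof (rule uniform_limitI)
  fix \<epsilon> :: real assume \<epsilon>: "\<epsilon> > 0"
  obtain \<delta>0 where \<delta>0: "\<delta>0 > 0"
    "\<And>x y. x \<in> {a..b} \<Longrightarrow> y \<in> {a..b} \<Longrightarrow> \<bar>x - y\<bar> < \<delta>0 \<Longrightarrow> \<bar>f x - f y\<bar> \<le> \<epsilon> / 2"
    by (rule uniform_modulus[OF assms(2) half_gt_zero[OF \<epsilon>]]) blast
  \<comment> \<open>Halving \<open>\<delta>0\<close> makes closed windows of length
    \<open>\<delta>\<close> fit the strict inequality of the modulus; the other two terms keep these
    windows inside \<open>{a..b}\<close> for every \<open>x\<close> in
    \<open>{c..d}\<close>.\<close>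
  define \<delta> where "\<delta> = min (\<delta>0 / 2) (min (c - a) (b - d))"
  have \<delta>: "\<delta> > 0" "\<delta> < \<delta>0" "\<delta> \<le> c - a" "\<delta> \<le> b - d"
    using \<delta>0(1) assms by (auto simp: \<delta>_def)
  \<comment> \<open>chosen so that \<open>(b - a) \<eta>\<^sup>p\<close> is half of the lower bound \<open>\<delta> (\<epsilon>/2)\<^sup>p\<close>\<close>
  define \<eta> where "\<eta> = (\<delta> / (2 * (b - a))) powr (1 / p) * (\<epsilon> / 2)"
  have \<eta>: "\<eta> > 0" using \<delta>(1) \<epsilon> assms(1) by (simp add: \<eta>_def)
  have "\<eta> powr p = \<delta> / (2 * (b - a)) * (\<epsilon> / 2) powr p"
    unfolding \<eta>_def using \<delta>(1) \<epsilon> assms(1,6)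
    by (subst powr_mult) (simp_all add: powr_powr del: times_divide_eq_right)
  then have "(b - a) * \<eta> powr p = \<delta> * (\<epsilon> / 2) powr p / 2"
    using assms(1) by (simp add: field_simps)
  moreover have "\<delta> * (\<epsilon> / 2) powr p > 0" using \<delta>(1) \<epsilon> by simp
  ultimately have small: "(b - a) * \<eta> powr p < \<delta> * (\<epsilon> / 2) powr p" by linarith
  obtain \<rho> where \<rho>: "\<rho> > 0"
    "\<And>x y. x \<in> {a..b} \<Longrightarrow> y \<in> {a..b} \<Longrightarrow> \<bar>x - y\<bar> < \<rho> \<Longrightarrow> \<bar>f x - f y\<bar> \<le> \<eta>"
    by (rule uniform_modulus[OF assms(2) \<eta>]) blast
  have "\<forall>\<^sub>F n in sequentially. partition_norm (\<Delta> n) < \<rho>"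
    using assms(5) \<rho>(1) by (rule order_tendstoD)
  then show "\<forall>\<^sub>F n in sequentially. \<forall>x\<in>{c..d}. dist (s n x) (f x) < \<epsilon>"
    \<comment> \<open>Index 0 is excluded because partitions and approximations are constrained only
      from 1 on.\<close>
    using eventually_ge_at_top[of 1]
  proof eventually_elim
    case (elim n)
    have modulus: "\<bar>f x - f y\<bar> \<le> \<eta>"
      if "x \<in> {a..b}" "y \<in> {a..b}" "\<bar>x - y\<bar> \<le> partition_norm (\<Delta> n)" for x y
      using \<rho>(2)[of x y] elim(1) that by simp
    obtain g where g: "g \<in> SI m l a b (\<Delta> n)" "\<And>x. x \<in> {a..b} \<Longrightarrow> \<bar>f x - g x\<bar> \<le> \<eta>"
      by (rule SI_close_approx_exists[OF assms(1) assms(4)[OF elim(2)] assms(3,7) modulus]) blast+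
    have best: "s n \<in> SI m l a b (\<Delta> n)"
      "Lp_norm p a b (\<lambda>x. f x - s n x) \<le> Lp_norm p a b (\<lambda>x. f x - g x)"
      using assms(8)[OF elim(2)] g(1) by (auto simp: is_best_SI_approx_def)
    note conts = SI_continuous_on[OF best(1)] SI_continuous_on[OF g(1)] assms(2)
    \<comment> \<open>Optimality against the competitor \<open>g\<close> pushes the error integral
      below the amount that one bad point of \<open>{c..d}\<close> would force. None of the
      constants depends on that point, hence the uniformity.\<close>
    have "integral {a..b} (\<lambda>x. \<bar>f x - s n x\<bar> powr p) \<le> integral {a..b} (\<lambda>x. \<bar>f x - g x\<bar> powr p)"
      using best(2) assms(6) by (intro Lp_norm_leD continuous_intros conts) auto
    also have "\<dots> \<le> (b - a) * \<eta> powr p"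
      using g(2) assms(1,6) by (intro integral_abs_powr_le continuous_intros conts) auto
    also note small
    finally have less: "integral {a..b} (\<lambda>x. \<bar>f x - s n x\<bar> powr p) < \<delta> * (\<epsilon> / 2) powr p" .
    show ?case
    proof (rule ballI, rule ccontr)
      fix x assume x: "x \<in> {c..d}" and "\<not> dist (s n x) (f x) < \<epsilon>"
      then have far: "\<epsilon> \<le> \<bar>s n x - f x\<bar>" by (simp add: dist_real_def)
      have "\<delta> * (\<epsilon> / 2) powr p \<le> integral {a..b} (\<lambda>x. \<bar>f x - s n x\<bar> powr p)"
      proof (rule mono_Lp_error_lower_bound[OF _ conts(1,3) _ \<delta>(1) _ _ \<epsilon> _ far])
        show "mono_on {a..b} (s n)" using best(1) by (simp add: SI_def)
        show "p > 0" "a + \<delta> \<le> x" "x \<le> b - \<delta>" using assms(6) \<delta> x by auto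
        fix y assume "y \<in> {a..b}" "\<bar>y - x\<bar> \<le> \<delta>"
        then show "\<bar>f y - f x\<bar> \<le> \<epsilon> / 2" using \<delta>0(2) \<delta>(2) x assms(9,11) by auto
      qed
      with less show False by simp
    qed
  qed
qed

end
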